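(* Let $k, b, d, N$ be positive integers such that every positive integer $n > N$ can be written as a sum of at most $b$ positive $k$-th powers. Suppose there exists a positive integer $n^*$ that is $(j,k)$-representable for every $j$ with $d \le j < b+d$. Then every positive integer greater than $N + n^*$ is $(b+d,k)$-representable.
   Context: For positive integers $j,k$, a positive integer $n$ is called $(j,k)$-representable if $n = x_1^k + \cdots + x_j^k$ with all $x_i$ positive integers. *)

theory Defs
  imports Main
begin

definition representable :: "nat \<Rightarrow> nat \<Rightarrow> nat \<Rightarrow> bool" where
  "representable j k n \<longleftrightarrow>
     (\<exists>x :: nat \<Rightarrow> nat. (\<forall>i\<in>{1..j}. 0 < x i) \<and> n = (\<Sum>i = 1..j. x i ^ k))"

end

theory Submission
  imports Defs
begin

text \<open>Subtracting \<open>nstar\<close> from \<open>n\<close> leaves a number above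
  \<open>N\<close>, hence a sum of \<open>j\<close> positive k-th powers for some \<open>j\<close>
  between 1 and \<open>b\<close> that cannot be prescribed. The flexibility of \<open>nstar\<close>
  compensates: it can be written with exactly the missing \<open>b + d - j\<close> powers. Joining
  the two sums, which is \<open>representable_add\<close>, gives exactly \<open>b + d\<close> powers
  whatever \<open>j\<close> was.\<close>

lemma representable_add:
  assumes "representable i k m" and "representable j k n"
  shows "representable (i + j) k (m + n)"
proof -
  obtain x where x: "\<forall>l\<in>{1..i}. 0 < x l" "m = (\<Sum>l = 1..i. x l ^ k)"
    using assms(1) unfolding representable_def by blast
  obtain y where y: "\<forall>l\<in>{1..j}. 0 < y l" "n = (\<Sum>l = 1..j. y l ^ k)"
    using assms(2) unfolding representable_def by blast
  \<comment> \<open>Concatenation of the two families: \<open>x\<close> fills the first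
    \<open>i\<close> places and \<open>y\<close>, shifted by \<open>i\<close>, the next
    \<open>j\<close>.\<close>
  define z where "z l = (if l \<le> i then x l else y (l - i))" for l
  have "\<forall>l\<in>{1..i + j}. 0 < z l"
  proof
    fix l assume "l \<in> {1..i + j}"
    then have "if l \<le> i then l \<in> {1..i} else l - i \<in> {1..j}"
      by auto
    then show "0 < z l"
      using x(1) y(1) unfolding z_def by (cases "l \<le> i") simp_all
  qed
  moreover have "(\<Sum>l = 1..i + j. z l ^ k) = m + n"
  proof -
    have "(\<Sum>l = 1..i + j. z l ^ k) = (\<Sum>l = 1..i. z l ^ k) + (\<Sum>l = i + 1..i + j. z l ^ k)"
      by (rule sum.ub_add_nat) simp
    also have "(\<Sum>l = 1..i. z l ^ k) = m"
      unfolding x(2) by (rule sum.cong) (auto simp: z_def)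
    also have "(\<Sum>l = i + 1..i + j. z l ^ k) = (\<Sum>l = 1..j. z (l + i) ^ k)"
      using sum.shift_bounds_cl_nat_ivl[of "\<lambda>l. z l ^ k" 1 i j] by (simp add: add.commute)
    \<comment> \<open>Indices here start at 1, so \<open>l + i\<close> exceeds \<open>i\<close> and
      \<open>z\<close> falls in its \<open>y\<close> branch.\<close>
    also have "\<dots> = n"
      unfolding y(2) by (rule sum.cong) (auto simp: z_def)
    finally show ?thesis .
  qed
  ultimately show ?thesis
    unfolding representable_def by metis
qed

theorem theorem2p1:
  fixes k b d N nstar :: nat
  assumes "0 < k" and "0 < b" and "0 < d" and "0 < N"
    and "\<forall>n > N. \<exists>j. 1 \<le> j \<and> j \<le> b \<and> representable j k n"
    and "0 < nstar"
    and "\<forall>j. d \<le> j \<and> j < b + d \<longrightarrow> representable j k nstar"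
  shows "\<forall>n > N + nstar. representable (b + d) k n"
proof (intro allI impI)
  fix n assume n: "N + nstar < n"
  then have "N < n - nstar" by simp
  then obtain j where j: "1 \<le> j" "j \<le> b" "representable j k (n - nstar)"
    using assms(5) by blast
  \<comment> \<open>The two bounds on \<open>j\<close> match the window for \<open>nstar\<close>:
    \<open>j \<le> b\<close> gives the lower end, \<open>1 \<le> j\<close> the strict upper
    end.\<close>
  have "d \<le> b + d - j \<and> b + d - j < b + d"
    using j \<open>0 < b\<close> by linarith
  then have "representable (b + d - j) k nstar"
    using assms(7) by blast
  \<comment> \<open>Neither natural subtraction truncates, since \<open>j \<le> b\<close> and
    \<open>nstar < n\<close>, so both the counts and the values add up as wanted.\<close>
  from representable_add[OF j(3) this] show "representable (b + d) k n"
    using j n by simp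
qed

end
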